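(* Let $h:\mathbb{R}\to\mathbb{C}$ be the characteristic function of a real random variable, let $\lambda\in(0,1)$, and for each positive integer $n$ define the characteristic function $$g_n(t)=\Bigl(1-\frac{\lambda}{n}\Bigr)+\frac{\lambda}{n}\,h(t),\qquad t\in\mathbb{R}.$$ Let $\mathfrak{h}$ be the characteristic function of a random variable taking values in the nonnegative integers, with probability generating function $\mathcal{P}(z)$, and suppose that the first derivative $\mathcal{P}'(1)$ of $\mathcal{P}$ at the point $z=1$ exists. Then, for every $t\in\mathbb{R}$, $$\lim_{n\to\infty}\mathfrak{h}^n\bigl(-i\log g_n(t)\bigr)=\exp\{a\,(h(t)-1)\},\qquad\text{where } a=\lambda\,\mathcal{P}'(1).$$
   Context: The probability generating function of a nonnegative-integer-valued random variable $X$ is $\mathcal{P}(z)=\sum_{k\ge 0}\mathbb{P}(X=k)z^k$, defined for complex $z$ with $|z|\le 1$; the characteristic function of $X$ is $\mathfrak{h}(s)=\mathcal{P}(e^{is})$. Existence of $\mathcal{P}'(1)$ means that the finite derivative of $\mathcal{P}$ at $z=1$ exists, taken relative to the closed unit disc. For complex $w$ with $|w|\le 1$, the expression $\mathfrak{h}(-i\log w)$ denotes $\mathcal{P}(w)$ (obtained by formally substituting $s=-i\log w$ in $\mathfrak{h}(s)=\mathcal{P}(e^{is})$; it does not depend on the choice of branch of the logarithm). The notation $\mathfrak{h}^n(-i\log g_n(t))$ denotes the $n$-th power $\bigl(\mathfrak{h}(-i\log g_n(t))\bigr)^n=\bigl(\mathcal{P}(g_n(t))\bigr)^n$. *)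

theory Defs
  imports "HOL-Probability.Probability"
begin

text \<open>
  Meaningful for \<open>norm z \<le> 1\<close>, where the series converges absolutely.
\<close>

definition pgf :: "'a measure \<Rightarrow> ('a \<Rightarrow> nat) \<Rightarrow> complex \<Rightarrow> complex" where
  "pgf M X z = (\<Sum>k. of_real (\<P>(\<omega> in M. X \<omega> = k)) * z ^ k)"

text \<open>
  The value \<open>\<hh>(-i log w)\<close> of the characteristic function \<open>\<hh>\<close> of \<open>X\<close>, obtained by
  formally substituting \<open>s = -i log w\<close> in \<open>\<hh>(s) = pgf M X (exp (i s))\<close>. The result does
  not depend on the branch of the logarithm and extends to \<open>w = 0\<close>; note that substituting
  the library function \<open>Ln\<close> literally would give the wrong value at \<open>w = 0\<close>, as \<open>Ln 0 = 0\<close>.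
\<close>

definition char_neg_i_log :: "'a measure \<Rightarrow> ('a \<Rightarrow> nat) \<Rightarrow> complex \<Rightarrow> complex" where
  "char_neg_i_log M X w = pgf M X w"

lemma char_neg_i_log_iexp:
  assumes "prob_space M" and X: "X \<in> measurable M (count_space UNIV)"
  shows "char_neg_i_log M X (iexp s) = char (distr M borel (\<lambda>\<omega>. real (X \<omega>))) s"
proof -
  interpret prob_space M by fact
  have meas: "(\<lambda>\<omega>. real (X \<omega>)) \<in> borel_measurable M"
    using X by measurable
  have bnd: "norm (iexp (s * real k)) \<le> 1" for k
    by (simp add: norm_exp_i_times)
  have term_eq: "(\<Sum>j\<in>{k}. of_real (\<P>(\<omega> in M. X \<omega> = j)) * iexp s ^ j)
      = (CLINT \<omega>|M. indicator {\<omega> \<in> space M. X \<omega> = k} \<omega> *\<^sub>R iexp (s * real k))" for k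
  proof -
    have "{\<omega> \<in> space M. X \<omega> = k} \<in> events" using X by measurable
    then show ?thesis
      by (simp add: exp_of_nat_mult [symmetric] scaleR_conv_of_real algebra_simps less_top [symmetric])
  qed
  have "(\<lambda>k. CLINT \<omega>|M. indicator {\<omega> \<in> space M. X \<omega> = k} \<omega> *\<^sub>R iexp (s * real k)) sums
        (CLINT \<omega>|M. iexp (s * real (X \<omega>)))"
    unfolding sums_def
  proof -
    have ev: "{\<omega> \<in> space M. X \<omega> = k} \<in> events" for k using X by measurable
    have int: "integrable M (\<lambda>\<omega>. indicator {\<omega> \<in> space M. X \<omega> = k} \<omega> *\<^sub>R iexp (s * real k))" for k
      using ev[of k] by (intro integrable_scaleR_left) (simp add: less_top [symmetric])
    have pw: "(\<Sum>k<n. indicator {\<omega> \<in> space M. X \<omega> = k} \<omega> *\<^sub>R iexp (s * real k))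
        = (if X \<omega> < n then iexp (s * real (X \<omega>)) else 0)" if "\<omega> \<in> space M" for n \<omega>
    proof -
      have "(\<Sum>k<n. indicator {\<omega> \<in> space M. X \<omega> = k} \<omega> *\<^sub>R iexp (s * real k))
        = (\<Sum>k<n. if X \<omega> = k then iexp (s * real k) else 0)"
        using that by (intro sum.cong) (auto simp: indicator_def)
      then show ?thesis by simp
    qed
    have "(\<lambda>n. CLINT \<omega>|M. (if X \<omega> < n then iexp (s * real (X \<omega>)) else 0)) \<longlonglongrightarrow>
        (CLINT \<omega>|M. iexp (s * real (X \<omega>)))"
    proof (rule integral_dominated_convergence[where w = "\<lambda>_. 1"])
      show "(\<lambda>\<omega>. iexp (s * real (X \<omega>))) \<in> borel_measurable M"
        using meas by measurable
      show "(\<lambda>\<omega>. if X \<omega> < n then iexp (s * real (X \<omega>)) else 0) \<in> borel_measurable M" for n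
        using meas X by measurable
      show "AE \<omega> in M. (\<lambda>n. if X \<omega> < n then iexp (s * real (X \<omega>)) else 0) \<longlonglongrightarrow> iexp (s * real (X \<omega>))"
      proof (rule AE_I2)
        fix \<omega>
        show "(\<lambda>n. if X \<omega> < n then iexp (s * real (X \<omega>)) else 0) \<longlonglongrightarrow> iexp (s * real (X \<omega>))"
          by (rule tendsto_eventually) (auto intro!: eventually_sequentiallyI[of "Suc (X \<omega>)"])
      qed
      show "AE \<omega> in M. norm (if X \<omega> < n then iexp (s * real (X \<omega>)) else 0) \<le> 1" for n
        using bnd by (intro AE_I2) (auto simp del: of_real_mult)
    qed simp
    moreover have "(CLINT \<omega>|M. (if X \<omega> < n then iexp (s * real (X \<omega>)) else 0))
       = (\<Sum>k<n. CLINT \<omega>|M. indicator {\<omega> \<in> space M. X \<omega> = k} \<omega> *\<^sub>R iexp (s * real k))" for n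
    proof -
      have "(CLINT \<omega>|M. (if X \<omega> < n then iexp (s * real (X \<omega>)) else 0))
         = (CLINT \<omega>|M. (\<Sum>k<n. indicator {\<omega> \<in> space M. X \<omega> = k} \<omega> *\<^sub>R iexp (s * real k)))"
        by (intro Bochner_Integration.integral_cong refl) (simp only: pw)
      also have "\<dots> = (\<Sum>k<n. CLINT \<omega>|M. indicator {\<omega> \<in> space M. X \<omega> = k} \<omega> *\<^sub>R iexp (s * real k))"
        by (rule Bochner_Integration.integral_sum) (rule int)
      finally show ?thesis .
    qed
    ultimately show "(\<lambda>n. \<Sum>k<n. CLINT \<omega>|M. indicator {\<omega> \<in> space M. X \<omega> = k} \<omega> *\<^sub>R iexp (s * real k))
        \<longlonglongrightarrow> (CLINT \<omega>|M. iexp (s * real (X \<omega>)))"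
      by simp
  qed
  then have "char_neg_i_log M X (iexp s) = (CLINT \<omega>|M. iexp (s * real (X \<omega>)))"
    unfolding char_neg_i_log_def pgf_def
    using term_eq by (simp add: sums_iff)
  also have "\<dots> = char (distr M borel (\<lambda>\<omega>. real (X \<omega>))) s"
    unfolding char_def using meas by (subst integral_distr) auto
  finally show ?thesis .
qed

end

theory Submission
  imports Defs
begin

text \<open>
  A derivative at \<open>1\<close> relative to the disc gives \<open>n (\<P>(g\<^sub>n(t)) - 1) \<longlonglongrightarrow> \<lambda> \<P>'(1) (h(t) - 1)\<close>,
  since \<open>g\<^sub>n(t)\<close> stays in the disc and \<open>n (g\<^sub>n(t) - 1) = \<lambda> (h(t) - 1)\<close>. Apart from \<open>\<P>(1) = 1\<close>,
  the rest is the complex form of the exponential limit.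
\<close>

text \<open>The difference \<open>w n - x\<close> is \<open>1/n\<close> times a convergent sequence;
  the rewriting needs \<open>n > 0\<close>.\<close>

lemma tendsto_of_nat_mult_diff:
  fixes w :: "nat \<Rightarrow> 'a::real_normed_field"
  assumes "(\<lambda>n. of_nat n * (w n - x)) \<longlonglongrightarrow> c"
  shows "w \<longlonglongrightarrow> x"
proof -
  have "(\<lambda>n. inverse (of_nat n) * (of_nat n * (w n - x)) + x) \<longlonglongrightarrow> 0 * c + x"
    by (intro tendsto_intros assms lim_inverse_n)
  moreover have "\<forall>\<^sub>F n in sequentially. inverse (of_nat n) * (of_nat n * (w n - x)) + x = w n"
    using eventually_gt_at_top[of 0] by eventually_elim (simp add: field_simps)
  ultimately show ?thesis
    using Lim_transform_eventually by fastforce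
qed

text \<open>Caratheodory's slope function \<open>q\<close> replaces the difference quotient, so
  \<open>w n = x\<close> is allowed; this occurs below when \<open>h t = 1\<close>.\<close>

lemma Caratheodory_tendsto:
  fixes f :: "'a::real_normed_field \<Rightarrow> 'a" and w :: "nat \<Rightarrow> 'a"
  assumes f: "(f has_field_derivative D) (at x within S)"
    and S: "\<And>n. w n \<in> S"
    and w: "(\<lambda>n. of_nat n * (w n - x)) \<longlonglongrightarrow> c"
  shows "(\<lambda>n. of_nat n * (f (w n) - f x)) \<longlonglongrightarrow> D * c"
proof -
  obtain q where q: "\<And>z. f z - f x = q z * (z - x)"
    and q_cont: "continuous (at x within S) q" and q_x: "q x = D"
    using f unfolding DERIV_caratheodory_within by blast
  have "w \<longlonglongrightarrow> x"
    by (rule tendsto_of_nat_mult_diff) (rule w)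
  then have "(\<lambda>n. q (w n)) \<longlonglongrightarrow> D"
    using continuous_within_tendsto_compose'[OF q_cont] S q_x by auto
  from tendsto_mult[OF this w] show ?thesis
    by (simp add: q mult.left_commute)
qed

text \<open>Since \<open>Ln\<close> has value 0 and derivative 1 at 1, \<open>n * Ln (u n)\<close>
  has the same limit \<open>c\<close>; then exponentiate.\<close>

lemma tendsto_power_exp:
  fixes u :: "nat \<Rightarrow> complex"
  assumes u: "(\<lambda>n. of_nat n * (u n - 1)) \<longlonglongrightarrow> c"
  shows "(\<lambda>n. u n ^ n) \<longlonglongrightarrow> exp c"
proof -
  have "(Ln has_field_derivative 1) (at 1 within UNIV)"
    by (auto intro!: derivative_eq_intros)
  from Caratheodory_tendsto[OF this _ u]
  have "(\<lambda>n. exp (of_nat n * Ln (u n))) \<longlonglongrightarrow> exp c"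
    by (auto intro: tendsto_exp)
  \<comment> \<open>With \<open>Ln 0 = 0\<close>, the exponential would be 1 rather than
    \<open>0 ^ n\<close> at a zero of \<open>u\<close>.\<close>
  moreover have "\<forall>\<^sub>F n in sequentially. u n \<noteq> 0"
    using tendsto_of_nat_mult_diff[OF u] by (rule tendsto_imp_eventually_ne) simp
  then have "\<forall>\<^sub>F n in sequentially. exp (of_nat n * Ln (u n)) = u n ^ n"
    by eventually_elim (simp add: exp_of_nat_mult)
  ultimately show ?thesis
    by (rule Lim_transform_eventually)
qed

text \<open>As \<open>iexp 0 = 1\<close>, this is the value of a characteristic function at
  0.\<close>

lemma pgf_1:
  assumes "prob_space M" and X: "X \<in> measurable M (count_space UNIV)"
  shows "pgf M X 1 = 1"
proof -
  interpret prob_space M by fact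
  have "(\<lambda>\<omega>. real (X \<omega>)) \<in> borel_measurable M"
    using X by measurable
  then interpret D: real_distribution "distr M borel (\<lambda>\<omega>. real (X \<omega>))"
    by (rule real_distribution_distr)
  show ?thesis
    using char_neg_i_log_iexp[OF assms, of 0] D.char_zero by (simp add: char_neg_i_log_def)
qed

theorem theorem4p1:
  fixes M :: "'a measure" and Y :: "'a \<Rightarrow> real" and h :: "real \<Rightarrow> complex"
    and L :: "'b measure" and X :: "'b \<Rightarrow> nat" and D a :: complex
    and lam :: real and g :: "nat \<Rightarrow> real \<Rightarrow> complex"
  assumes "prob_space M" and "Y \<in> borel_measurable M" and "h = char (distr M borel Y)"
    and "0 < lam" and "lam < 1"
    and "\<And>n t. n \<ge> 1 \<Longrightarrow>
           g n t = (1 - of_real lam / of_nat n) + of_real lam / of_nat n * h t"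
    and "prob_space L" and "X \<in> measurable L (count_space UNIV)"
    and "(pgf L X has_field_derivative D) (at 1 within cball 0 1)"
    and "a = of_real lam * D"
  shows "\<forall>t. (\<lambda>n. char_neg_i_log L X (g n t) ^ n) \<longlonglongrightarrow> exp (a * (h t - 1))"
proof
  fix t
  interpret M: prob_space M by fact
  interpret D: real_distribution "distr M borel Y"
    using assms(2) by (rule M.real_distribution_distr)
  have h: "norm (h t) \<le> 1"
    unfolding assms(3) by (rule D.cmod_char_le_1)
  \<comment> \<open>Nothing is known about \<open>g 0\<close>, so the sequence is changed at \<open>n = 0\<close> to stay in the disc.\<close>
  define w where "w n = (if n = 0 then 1 else g n t)" for n
  have w_disc: "w n \<in> cball 0 1" for n
  proof (cases "n = 0")
    case False
    define r where "r = lam / real n"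
    have r: "0 \<le> r" "r \<le> 1"
      using assms(4,5) False by (auto simp: r_def divide_le_eq)
    \<comment> \<open>A convex combination of two points of the unit disc.\<close>
    have "w n = of_real (1 - r) * 1 + of_real r * h t"
      using False assms(6)[of n t] by (simp add: w_def r_def)
    also have "norm \<dots> \<le> norm (of_real (1 - r) * 1 :: complex) + norm (of_real r * h t)"
      by (rule norm_triangle_ineq)
    also have "\<dots> = (1 - r) + r * norm (h t)"
      using r by (simp only: norm_mult norm_of_real) simp
    also have "\<dots> \<le> 1"
      using mult_left_mono[OF h r(1)] by simp
    finally show ?thesis by simp
  qed (simp add: w_def)
  have "\<forall>\<^sub>F n in sequentially. of_real lam * (h t - 1) = of_nat n * (w n - 1)"
    using eventually_gt_at_top[of 0]
    by eventually_elim (simp add: w_def assms(6) field_simps)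
  then have "(\<lambda>n. of_nat n * (w n - 1)) \<longlonglongrightarrow> of_real lam * (h t - 1)"
    by (rule Lim_transform_eventually[OF tendsto_const])
  from Caratheodory_tendsto[OF assms(9) w_disc this]
  have "(\<lambda>n. of_nat n * (pgf L X (w n) - 1)) \<longlonglongrightarrow> a * (h t - 1)"
    using pgf_1[OF assms(7,8)] by (simp add: assms(10) mult_ac)
  then have "(\<lambda>n. pgf L X (w n) ^ n) \<longlonglongrightarrow> exp (a * (h t - 1))"
    by (rule tendsto_power_exp)
  \<comment> \<open>At \<open>n = 0\<close> both powers are 1, so the altered value does no
    harm.\<close>
  moreover have "pgf L X (w n) ^ n = char_neg_i_log L X (g n t) ^ n" for n
    by (simp add: w_def char_neg_i_log_def)
  ultimately show "(\<lambda>n. char_neg_i_log L X (g n t) ^ n) \<longlonglongrightarrow> exp (a * (h t - 1))"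
    by simp
qed

end
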